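(* Let $\bar{a}(N)$ denote the number of partitions $\lambda$ of $N$ with at least two parts, no parts of size $1$, and $\lambda_1=\lambda_2$. For every integer $j\ge 4$, $$PM(3j,j)-PM(3j-2,j-1)=\bar{a}(2j+1)+1.$$
   Context: A partition $\lambda=(\lambda_1\ge\cdots\ge\lambda_\ell)$ of $n$ is a finite nonincreasing sequence of positive integers with sum $n$; $\ell(\lambda)$ is its number of parts. The hook length $h_{(i,j)}(\lambda)$ of a cell $(i,j)$ of the Ferrers diagram is the number of cells consisting of the cell itself, the cells to its right in its row and the cells below it in its column. A numerical set is a subset $S\subseteq\mathbb{N}_0$ containing $0$ with finite complement; a numerical semigroup is a numerical set closed under addition. For a partition $\lambda$ let $S_\lambda=\mathbb{N}_0\setminus\{h_{(i,1)}(\lambda):1\le i\le\ell(\lambda)\}$. $PM(n,m)$ is the number of partitions $\lambda$ of $n$ having exactly $m-1$ parts equal to $1$ such that $S_\lambda$ is a numerical semigroup. *)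

theory Defs
  imports Main
begin

definition is_partition :: "nat list \<Rightarrow> nat \<Rightarrow> bool" where
  "is_partition l n \<longleftrightarrow> sorted_wrt (\<ge>) l \<and> (\<forall>x\<in>set l. x > 0) \<and> sum_list l = n"

(* Cells are indexed from 1, list positions from 0: the part \<lambda>_i is l ! (i - 1). *)
definition ferrers :: "nat list \<Rightarrow> (nat \<times> nat) set" where
  "ferrers l = {(i, j). 1 \<le> i \<and> i \<le> length l \<and> 1 \<le> j \<and> j \<le> l ! (i - 1)}"

(* Only meaningful for cells (i, j) of the diagram. *)
definition hook_length :: "nat list \<Rightarrow> nat \<Rightarrow> nat \<Rightarrow> nat" where
  "hook_length l i j =
     card {(i', j'). (i', j') \<in> ferrers l \<and> (i' = i \<and> j' \<ge> j \<or> j' = j \<and> i' \<ge> i)}"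

definition numerical_set :: "nat set \<Rightarrow> bool" where
  "numerical_set S \<longleftrightarrow> 0 \<in> S \<and> finite (- S)"

definition numerical_semigroup :: "nat set \<Rightarrow> bool" where
  "numerical_semigroup S \<longleftrightarrow> numerical_set S \<and> (\<forall>a\<in>S. \<forall>b\<in>S. a + b \<in> S)"

definition S_of :: "nat list \<Rightarrow> nat set" where
  "S_of l = UNIV - {hook_length l i 1 | i. 1 \<le> i \<and> i \<le> length l}"

(* "Exactly m - 1 parts equal to 1" is written without truncated subtraction. *)
definition PM :: "nat \<Rightarrow> nat \<Rightarrow> nat" where
  "PM n m = card {l. is_partition l n \<and> count_list l 1 + 1 = m \<and> numerical_semigroup (S_of l)}"

definition a_bar :: "nat \<Rightarrow> nat" where
  "a_bar N = card {l. is_partition l N \<and> length l \<ge> 2 \<and> 1 \<notin> set l \<and> l ! 0 = l ! 1}"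

(* The cardinalities in PM and a_bar are therefore taken over finite sets. *)
lemma finite_partitions: "finite {l. is_partition l n}"
proof (rule finite_subset)
  have "length l \<le> sum_list l" if "\<forall>x\<in>set l. x > 0" for l :: "nat list"
    using that by (induction l) auto
  then show "{l. is_partition l n} \<subseteq> {l. set l \<subseteq> {..n} \<and> length l \<le> n}"
    using member_le_sum_list by (auto simp: is_partition_def)
  show "finite {l. set l \<subseteq> {..n} \<and> length l \<le> n}"
    by (rule finite_lists_length_le) simp
qed

end

theory Submission
  imports Defs
begin

text \<open>
  Delete the \<open>p = m - 1\<close> ones from a partition counted by \<open>PM n m\<close>. What remains is a partition
  \<open>\<mu>\<close> without ones, of \<open>2 j + 1\<close> for \<open>PM (3 j) j\<close>, where \<open>p = j - 1\<close>, and of \<open>2 j\<close> for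
  \<open>PM (3 j - 2) (j - 1)\<close>, where \<open>p = j - 2\<close>. The gaps are \<open>1, \<dots>, p\<close> and \<open>p + h\<close> for \<open>h\<close> in
  the set \<open>H\<close> of first-column hook lengths of \<open>\<mu>\<close>, so the semigroup condition says that
  \<open>p + u + v \<notin> H\<close> for all positive \<open>u, v \<notin> H\<close>. A size estimate shows that, with few exceptions,
  only the largest element of \<open>H\<close> can exceed \<open>p + 1\<close>. Raising the largest part and \<open>p\<close> by one
  moves this element and \<open>p\<close> in parallel, so it preserves the condition; its image is the set of
  \<open>\<mu>\<close> with \<open>\<mu>\<^sub>1 > \<mu>\<^sub>2\<close>. The exceptions are the \<open>j - 2\<close> partitions \<open>(a, a, 2, \<dots>, 2)\<close> of \<open>2 j\<close> with
  \<open>a < j\<close>, which satisfy the condition only after the raise. The \<open>\<mu>\<close> with \<open>\<mu>\<^sub>1 = \<mu>\<^sub>2\<close> all satisfy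
  the condition, except for the \<open>j - 3\<close> partitions \<open>(a, a, 3, 2, \<dots>, 2)\<close> of \<open>2 j + 1\<close>.
\<close>

section \<open>First-column hook lengths\<close>

fun first_column_hooks :: "nat list \<Rightarrow> nat set" where
  "first_column_hooks [] = {}"
| "first_column_hooks (x # xs) = insert (x + length xs) (first_column_hooks xs)"

lemma first_column_hooks_conv_nth:
  "first_column_hooks l = (\<lambda>i. l ! i + (length l - Suc i)) ` {..<length l}"
proof (induction l)
  case (Cons x xs)
  then show ?case by (simp add: lessThan_Suc_eq_insert_0 image_image)
qed simp

lemma hook_length_first_column:
  assumes "\<forall>x\<in>set l. 0 < x" "1 \<le> i" "i \<le> length l"
  shows "hook_length l i 1 = l ! (i - 1) + (length l - i)"
proof -
  have pos: "1 \<le> l ! (k - 1)" if "1 \<le> k" "k \<le> length l" for k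
    using assms(1) that by (simp add: Suc_leI)
  have "{(i', j'). (i', j') \<in> ferrers l \<and> (i' = i \<and> j' \<ge> 1 \<or> j' = 1 \<and> i' \<ge> i)}
     = {i} \<times> {1..l ! (i - 1)} \<union> {i<..length l} \<times> {1}"
    (is "?L = ?R")
  proof (rule set_eqI)
    fix c :: "nat \<times> nat"
    obtain a b where c: "c = (a, b)" by fastforce
    show "c \<in> ?L \<longleftrightarrow> c \<in> ?R"
      using assms(2,3) pos[of a] unfolding c by (cases "a = i") (auto simp: ferrers_def)
  qed
  moreover have "card ({i} \<times> {1..l ! (i - 1)} \<union> {i<..length l} \<times> {1}) = l ! (i - 1) + (length l - i)"
    by (subst card_Un_disjoint) (auto simp: card_cartesian_product)
  ultimately show ?thesis by (simp add: hook_length_def)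
qed

lemma S_of_eq_Compl_first_column_hooks:
  assumes "\<forall>x\<in>set l. 0 < x"
  shows "S_of l = - first_column_hooks l"
proof -
  have "{hook_length l i 1 | i. 1 \<le> i \<and> i \<le> length l} = (\<lambda>i. hook_length l i 1) ` {1..length l}"
    by auto
  also have "\<dots> = (\<lambda>i. hook_length l (Suc i) 1) ` {..<length l}"
    by (simp only: image_image flip: image_Suc_lessThan)
  also have "\<dots> = first_column_hooks l"
    unfolding first_column_hooks_conv_nth
    by (rule image_cong[OF refl]) (subst hook_length_first_column[OF assms]; simp)
  finally show ?thesis by (simp add: S_of_def Compl_eq_Diff_UNIV)
qed

lemma finite_first_column_hooks: "finite (first_column_hooks l)"
  by (induction l) auto

lemma first_column_hooks_append:
  "first_column_hooks (xs @ ys) = (+) (length ys) ` first_column_hooks xs \<union> first_column_hooks ys"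
  by (induction xs) (simp_all add: ac_simps)

lemma first_column_hooks_replicate: "first_column_hooks (replicate n k) = {k..<k + n}"
  by (induction n) (simp_all add: atLeastLessThanSuc)

lemma first_column_hooks_lower_bound:
  assumes "\<forall>x\<in>set l. k \<le> x" "h \<in> first_column_hooks l"
  shows "k \<le> h"
  using assms by (induction l) auto

lemma first_column_hooks_upper_bound:
  assumes "sorted_wrt (\<ge>) (x # xs)" "h \<in> first_column_hooks (x # xs)"
  shows "h \<le> x + length xs"
  using assms
proof (induction xs arbitrary: x)
  case (Cons y ys)
  then show ?case by fastforce
qed simp


section \<open>The semigroup condition\<close>

lemma Compl_atLeastAtMost_Un_shift:
  fixes H :: "nat set"
  assumes "0 \<notin> H"
  shows "- ({1..p} \<union> (+) p ` H) = insert 0 ((+) p ` {u. 0 < u \<and> u \<notin> H})"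
    (is "?S = ?T")
proof (intro equalityI subsetI)
  fix a assume a: "a \<in> ?S"
  show "a \<in> ?T"
  proof (cases "a = 0")
    case False
    with a obtain u where "0 < u" "p + u = a" using less_imp_add_positive[of p a] by auto
    with a show ?thesis by blast
  qed simp
qed (use assms in auto)

lemma numerical_semigroup_Compl_shift:
  assumes "finite H" "0 \<notin> H"
  shows "numerical_semigroup (- ({1..p} \<union> (+) p ` H)) \<longleftrightarrow>
    (\<forall>u>0. \<forall>v>0. u \<notin> H \<longrightarrow> v \<notin> H \<longrightarrow> p + u + v \<notin> H)"
    (is "numerical_semigroup ?S \<longleftrightarrow> _")
proof -
  let ?X = "{u. 0 < u \<and> u \<notin> H}"
  have "numerical_set ?S" using assms by (auto simp: numerical_set_def)
  then have "numerical_semigroup ?S \<longleftrightarrow> (\<forall>a\<in>?S. \<forall>b\<in>?S. a + b \<in> ?S)"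
    by (simp only: numerical_semigroup_def simp_thms)
  also have "\<dots> \<longleftrightarrow> (\<forall>u\<in>?X. \<forall>v\<in>?X. (p + u) + (p + v) \<in> ?S)"
    unfolding Compl_atLeastAtMost_Un_shift[OF assms(2)] by simp
  also have "\<dots> \<longleftrightarrow> (\<forall>u\<in>?X. \<forall>v\<in>?X. p + u + v \<notin> H)"
  proof (intro ball_cong refl)
    fix u v assume "u \<in> ?X" "v \<in> ?X"
    then have "p + (p + u + v) \<in> ?S \<longleftrightarrow> p + u + v \<notin> H" by auto
    moreover have "(p + u) + (p + v) = p + (p + u + v)" by simp
    ultimately show "(p + u) + (p + v) \<in> ?S \<longleftrightarrow> p + u + v \<notin> H" by (simp only:)
  qed
  finally show ?thesis by blast
qed

definition semigroup_with_ones :: "nat \<Rightarrow> nat list \<Rightarrow> bool" where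
  "semigroup_with_ones p \<mu> \<longleftrightarrow> numerical_semigroup (S_of (\<mu> @ replicate p 1))"

lemma semigroup_with_ones_iff:
  assumes "\<forall>x\<in>set \<mu>. 0 < x"
  shows "semigroup_with_ones p \<mu> \<longleftrightarrow>
    (\<forall>u>0. \<forall>v>0. u \<notin> first_column_hooks \<mu> \<longrightarrow> v \<notin> first_column_hooks \<mu> \<longrightarrow>
      p + u + v \<notin> first_column_hooks \<mu>)"
proof -
  have "S_of (\<mu> @ replicate p 1) = - first_column_hooks (\<mu> @ replicate p 1)"
    using assms by (intro S_of_eq_Compl_first_column_hooks) auto
  also have "first_column_hooks (\<mu> @ replicate p 1) = {1..p} \<union> (+) p ` first_column_hooks \<mu>"
    by (auto simp: first_column_hooks_append first_column_hooks_replicate)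
  finally have "S_of (\<mu> @ replicate p 1) = - ({1..p} \<union> (+) p ` first_column_hooks \<mu>)" .
  moreover have "0 \<notin> first_column_hooks \<mu>"
    using assms first_column_hooks_lower_bound[of \<mu> 1] by (auto simp: Suc_le_eq)
  ultimately show ?thesis
    by (simp only: semigroup_with_ones_def
        numerical_semigroup_Compl_shift[OF finite_first_column_hooks] not_False_eq_True)
qed

lemma semigroup_with_ones_Cons:
  assumes pos: "\<forall>y\<in>set (x # xs). 0 < y" and hooks_le: "\<forall>h\<in>first_column_hooks xs. h \<le> Suc p"
  shows "semigroup_with_ones p (x # xs) \<longleftrightarrow>
    (\<forall>u>0. \<forall>v>0. u \<notin> first_column_hooks xs \<longrightarrow> v \<notin> first_column_hooks xs \<longrightarrow>
      p + u + v \<noteq> x + length xs)"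
proof -
  have "p + u + v \<notin> first_column_hooks xs" if "0 < u" "0 < v" for u v
    using hooks_le that by fastforce
  moreover have "u \<noteq> x + length xs" "v \<noteq> x + length xs"
    if "0 < u" "0 < v" "p + u + v = x + length xs" for u v
    using that by auto
  ultimately show ?thesis
    unfolding semigroup_with_ones_iff[OF pos] first_column_hooks.simps insert_iff by metis
qed

lemma semigroup_with_ones_raise:
  assumes "\<forall>y\<in>set (x # xs). 0 < y" "\<forall>h\<in>first_column_hooks xs. h \<le> Suc p"
  shows "semigroup_with_ones (Suc p) (Suc x # xs) \<longleftrightarrow> semigroup_with_ones p (x # xs)"
  using assms by (subst (1 2) semigroup_with_ones_Cons) (auto simp: le_SucI)

lemma not_semigroup_with_ones_if_hook:
  assumes parts_ge_2: "\<forall>x\<in>set \<mu>. 2 \<le> x" and "p + 2 \<in> first_column_hooks \<mu>"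
  shows "\<not> semigroup_with_ones p \<mu>"
proof -
  have "1 \<notin> first_column_hooks \<mu>" using first_column_hooks_lower_bound[OF parts_ge_2] by fastforce
  moreover have "p + 1 + 1 \<in> first_column_hooks \<mu>" using assms(2) by simp
  moreover have "\<forall>x\<in>set \<mu>. 0 < x" using parts_ge_2 by auto
  ultimately show ?thesis using semigroup_with_ones_iff zero_less_one by blast
qed


section \<open>Partitions without ones\<close>

definition partitions_without_ones :: "nat \<Rightarrow> nat list set" where
  "partitions_without_ones N = {\<mu>. is_partition \<mu> N \<and> 1 \<notin> set \<mu>}"

lemma partitions_without_ones_iff:
  "\<mu> \<in> partitions_without_ones N \<longleftrightarrow> sorted_wrt (\<ge>) \<mu> \<and> (\<forall>x\<in>set \<mu>. 2 \<le> x) \<and> sum_list \<mu> = N"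
proof -
  have "(\<forall>x\<in>set \<mu>. 0 < x) \<and> 1 \<notin> set \<mu> \<longleftrightarrow> (\<forall>x\<in>set \<mu>. 2 \<le> x)"
    by (induction \<mu>) auto
  then show ?thesis by (auto simp: partitions_without_ones_def is_partition_def)
qed

lemma finite_partitions_without_ones: "finite (partitions_without_ones N)"
  by (rule finite_subset[OF _ finite_partitions[of N]]) (auto simp: partitions_without_ones_def)

lemma sorted_wrt_ge_replicate: "sorted_wrt (\<ge>) (replicate n (x :: 'a :: preorder))"
  by (induction n) auto

lemma partition_split_ones:
  assumes "sorted_wrt (\<ge>) l" "\<forall>x\<in>set l. 0 < (x :: nat)"
  shows "filter (\<lambda>x. x \<noteq> 1) l @ replicate (count_list l 1) 1 = l"
  using assms
proof (induction l)
  case (Cons x xs)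
  show ?case
  proof (cases "x = 1")
    case True
    with Cons.prems have "\<forall>y\<in>set xs. y = 1" by force
    then have "filter (\<lambda>x. x \<noteq> 1) xs = []" by (auto simp: filter_empty_conv)
    with Cons True show ?thesis by simp
  qed (use Cons in auto)
qed simp

lemma append_ones_image:
  "(\<lambda>\<mu>. \<mu> @ replicate p 1) ` partitions_without_ones N
    = {l. is_partition l (N + p) \<and> count_list l 1 = p}" (is "?f ` _ = ?B")
proof (intro equalityI subsetI)
  fix l assume "l \<in> ?f ` partitions_without_ones N"
  then obtain \<mu> where \<mu>: "\<mu> \<in> partitions_without_ones N" "l = ?f \<mu>" by blast
  then have "count_list \<mu> 1 = 0" by (simp add: partitions_without_ones_def count_list_0_iff)
  moreover have "count_list (replicate p (1::nat)) 1 = p" by (induction p) auto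
  moreover have "is_partition l (N + p)"
    using \<mu> by (auto simp: partitions_without_ones_def is_partition_def sorted_wrt_append
        sorted_wrt_ge_replicate sum_list_replicate Suc_le_eq)
  ultimately show "l \<in> ?B" using \<mu>(2) by simp
next
  fix l assume l: "l \<in> ?B"
  define \<mu> where "\<mu> = filter (\<lambda>x. x \<noteq> 1) l"
  have l_eq: "l = ?f \<mu>"
    using partition_split_ones[of l] l by (auto simp: \<mu>_def is_partition_def)
  then have "sum_list l = sum_list \<mu> + p" by (simp add: sum_list_replicate)
  with l have "\<mu> \<in> partitions_without_ones N"
    by (simp add: \<mu>_def partitions_without_ones_def is_partition_def sorted_wrt_filter)
  with l_eq show "l \<in> ?f ` partitions_without_ones N" by blast
qed

lemma PM_eq_card_semigroup_with_ones:
  "PM (N + p) (Suc p) = card {\<mu> \<in> partitions_without_ones N. semigroup_with_ones p \<mu>}"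
proof -
  let ?f = "\<lambda>\<mu>. \<mu> @ replicate p (1 :: nat)"
  have "{l. is_partition l (N + p) \<and> count_list l 1 + 1 = Suc p \<and> numerical_semigroup (S_of l)}
    = {l \<in> ?f ` partitions_without_ones N. numerical_semigroup (S_of l)}"
    unfolding append_ones_image by auto
  also have "\<dots> = ?f ` {\<mu> \<in> partitions_without_ones N. semigroup_with_ones p \<mu>}"
    by (auto simp: semigroup_with_ones_def)
  finally show ?thesis by (simp add: PM_def card_image inj_on_def)
qed

lemma mult_length_le_sum_list:
  assumes "\<forall>x\<in>set xs. k \<le> x"
  shows "k * length xs \<le> sum_list (xs :: nat list)"
  using assms by (induction xs) auto

lemma sum_list_eq_mult_length:
  assumes "\<forall>x\<in>set xs. k \<le> x" "sum_list xs = k * length (xs :: nat list)"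
  shows "replicate (length xs) k = xs"
  using assms
proof (induction xs)
  case (Cons x xs)
  with mult_length_le_sum_list[of xs k] have "x = k" "sum_list xs = k * length xs" by auto
  with Cons show ?case by simp
qed simp

lemma sum_list_eq_Suc_mult_length:
  assumes parts_ge: "\<forall>x\<in>set xs. k \<le> x" and sorted: "sorted_wrt (\<ge>) xs"
    and sum: "sum_list xs = Suc (k * length (xs :: nat list))"
  obtains n where "xs = Suc k # replicate n k"
proof (cases xs)
  case (Cons y ys)
  have "y \<noteq> k"
  proof
    assume "y = k"
    with parts_ge sorted Cons have "\<forall>x\<in>set xs. x = k" by force
    then have "replicate (length xs) k = xs" by (rule replicate_length_same)
    then have "sum_list xs = k * length xs" using sum_list_replicate[of "length xs" k] by simp
    with sum show False by simp
  qed
  with parts_ge sum Cons mult_length_le_sum_list[of ys k]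
  have "y = Suc k" "sum_list ys = k * length ys" by auto
  with parts_ge Cons sum_list_eq_mult_length[of ys k] have "xs = Suc k # replicate (length ys) k" by simp
  then show ?thesis by (rule that)
qed (use sum in simp)


section \<open>Raising the largest part\<close>

fun repeats_largest_part :: "nat list \<Rightarrow> bool" where
  "repeats_largest_part (x # y # _) \<longleftrightarrow> x = y"
| "repeats_largest_part _ \<longleftrightarrow> False"

lemma a_bar_eq_card: "a_bar N = card {\<mu> \<in> partitions_without_ones N. repeats_largest_part \<mu>}"
proof -
  have "repeats_largest_part l \<longleftrightarrow> length l \<ge> 2 \<and> l ! 0 = l ! 1" for l
    by (cases l rule: repeats_largest_part.cases) auto
  then show ?thesis
    unfolding a_bar_def partitions_without_ones_def by (intro arg_cong[where f = card]) auto
qed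

fun raise_largest_part :: "nat list \<Rightarrow> nat list" where
  "raise_largest_part [] = []"
| "raise_largest_part (x # xs) = Suc x # xs"

lemma inj_raise_largest_part: "inj raise_largest_part"
proof (rule injI)
  fix \<mu> \<nu> assume "raise_largest_part \<mu> = raise_largest_part \<nu>"
  then show "\<mu> = \<nu>" by (cases \<mu>; cases \<nu>) auto
qed

lemma raise_largest_part_image:
  assumes "2 \<le> N"
  shows "raise_largest_part ` partitions_without_ones N
    = {\<nu> \<in> partitions_without_ones (Suc N). \<not> repeats_largest_part \<nu>}" (is "_ = ?U")
proof (intro equalityI subsetI)
  fix \<nu> assume "\<nu> \<in> raise_largest_part ` partitions_without_ones N"
  then obtain \<mu> where \<mu>: "\<mu> \<in> partitions_without_ones N" "\<nu> = raise_largest_part \<mu>" by blast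
  then obtain x xs where "\<mu> = x # xs"
    using assms by (cases \<mu>) (auto simp: partitions_without_ones_iff)
  with \<mu> show "\<nu> \<in> ?U"
    by (cases xs) (auto simp: partitions_without_ones_iff intro: le_SucI)
next
  fix \<nu> assume \<nu>: "\<nu> \<in> ?U"
  then obtain x xs where \<nu>_eq: "\<nu> = Suc x # xs"
    by (cases \<nu>) (auto simp: partitions_without_ones_iff numeral_2_eq_2 dest!: Suc_le_D)
  with \<nu> assms have "x # xs \<in> partitions_without_ones N"
    by (cases xs) (force simp: partitions_without_ones_iff)+
  moreover have "\<nu> = raise_largest_part (x # xs)" using \<nu>_eq by simp
  ultimately show "\<nu> \<in> raise_largest_part ` partitions_without_ones N" by blast
qed

definition doubled_part_and_twos :: "nat \<Rightarrow> nat list set" where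
  "doubled_part_and_twos p = (\<lambda>a. a # a # replicate (p + 2 - a) 2) ` {2..p + 1}"

lemma card_doubled_part_and_twos: "card (doubled_part_and_twos p) = p"
  unfolding doubled_part_and_twos_def by (subst card_image) (auto simp: inj_on_def)

lemma doubled_part_and_twos_subset: "doubled_part_and_twos p \<subseteq> partitions_without_ones (2 * p + 4)"
  by (auto simp: doubled_part_and_twos_def partitions_without_ones_iff sum_list_replicate
      sorted_wrt_ge_replicate)

lemma not_semigroup_doubled_part_and_twos:
  assumes "2 \<le> a" "a + n = p + 2"
  shows "\<not> semigroup_with_ones p (a # a # replicate n 2)"
  using assms by (intro not_semigroup_with_ones_if_hook) auto

lemma semigroup_raised_doubled_part_and_twos:
  assumes "1 \<le> p" "2 \<le> a" "a + n = p + 2"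
  shows "semigroup_with_ones (Suc p) (Suc a # a # replicate n 2) \<longleftrightarrow> 0 < n"
proof -
  let ?xs = "a # replicate n 2"
  have hooks: "first_column_hooks ?xs = insert (p + 2) {2..<2 + n}"
    using assms(3) by (simp add: first_column_hooks_replicate)
  have "semigroup_with_ones (Suc p) (Suc a # ?xs) \<longleftrightarrow>
    (\<forall>u>0. \<forall>v>0. u \<notin> first_column_hooks ?xs \<longrightarrow> v \<notin> first_column_hooks ?xs \<longrightarrow>
      Suc p + u + v \<noteq> Suc a + length ?xs)"
  proof (rule semigroup_with_ones_Cons)
    show "\<forall>y\<in>set (Suc a # ?xs). 0 < y" using assms(2) by auto
    show "\<forall>h\<in>first_column_hooks ?xs. h \<le> Suc (Suc p)" unfolding hooks using assms(2,3) by auto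
  qed
  also have "\<dots> \<longleftrightarrow>
    (\<forall>u>0. \<forall>v>0. u \<notin> first_column_hooks ?xs \<longrightarrow> v \<notin> first_column_hooks ?xs \<longrightarrow> u + v \<noteq> 3)"
  proof -
    have "Suc p + u + v = Suc a + length ?xs \<longleftrightarrow> u + v = 3" for u v
      using assms(3) by auto
    then show ?thesis by simp
  qed
  also have "\<dots> \<longleftrightarrow> 2 \<in> first_column_hooks ?xs"
  proof -
    have "1 \<notin> first_column_hooks ?xs" using hooks by simp
    moreover have "u + v = 3 \<longleftrightarrow> u = 1 \<and> v = 2 \<or> u = 2 \<and> v = 1" if "0 < u" "0 < v" for u v :: nat
      using that by arith
    ultimately show ?thesis by (metis zero_less_one zero_less_numeral)
  qed
  also have "\<dots> \<longleftrightarrow> 0 < n" using hooks assms(1) by simp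
  finally show ?thesis .
qed

lemma hooks_le_or_doubled_part_and_twos:
  assumes "x # xs \<in> partitions_without_ones (2 * p + 4)"
  obtains (hooks_le) "\<forall>h\<in>first_column_hooks xs. h \<le> Suc p"
    | (doubled) a n where "2 \<le> a" "a + n = p + 2" "x # xs = a # a # replicate n 2"
proof (cases xs)
  case (Cons y ys)
  have sorted: "sorted_wrt (\<ge>) (y # ys)" "y \<le> x" and parts_ge_2: "2 \<le> y" "\<forall>z\<in>set ys. 2 \<le> z"
    and sum: "x + y + sum_list ys = 2 * p + 4"
    using assms by (auto simp: Cons partitions_without_ones_iff)
  show ?thesis
  proof (cases "y + length ys \<le> Suc p")
    case True
    then show ?thesis
      using hooks_le first_column_hooks_upper_bound[OF sorted(1)] Cons by fastforce
  next
    case False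
    with sorted(2) sum mult_length_le_sum_list[OF parts_ge_2(2)]
    have "x = y" "y + length ys = p + 2" "sum_list ys = 2 * length ys" by auto
    then show ?thesis
      using doubled parts_ge_2 sum_list_eq_mult_length[OF parts_ge_2(2)] Cons by metis
  qed
qed (use hooks_le in simp)

lemma semigroup_raise_largest_part:
  assumes "1 \<le> p"
  shows "{\<mu> \<in> partitions_without_ones (2 * p + 4). semigroup_with_ones (Suc p) (raise_largest_part \<mu>)}
    = {\<mu> \<in> partitions_without_ones (2 * p + 4). semigroup_with_ones p \<mu>} \<union> doubled_part_and_twos p"
proof -
  have "semigroup_with_ones (Suc p) (raise_largest_part \<mu>) \<longleftrightarrow>
      semigroup_with_ones p \<mu> \<or> \<mu> \<in> doubled_part_and_twos p"
    if \<mu>: "\<mu> \<in> partitions_without_ones (2 * p + 4)" for \<mu>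
  proof -
    have raised: "semigroup_with_ones (Suc p) (raise_largest_part \<mu>)"
      if "\<mu> \<in> doubled_part_and_twos p"
      using that semigroup_raised_doubled_part_and_twos[OF assms]
      by (auto simp: doubled_part_and_twos_def)
    obtain x xs where \<mu>_eq: "\<mu> = x # xs"
      using \<mu> by (cases \<mu>) (auto simp: partitions_without_ones_iff)
    from \<mu>[unfolded \<mu>_eq] show ?thesis
    proof (cases rule: hooks_le_or_doubled_part_and_twos)
      case hooks_le
      have "\<forall>y\<in>set (x # xs). 0 < y" using \<mu> by (auto simp: \<mu>_eq partitions_without_ones_iff)
      from semigroup_with_ones_raise[OF this hooks_le] raised show ?thesis by (auto simp: \<mu>_eq)
    next
      case (doubled a n)
      then have "\<mu> \<in> doubled_part_and_twos p" if "0 < n"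
        using that by (auto simp: \<mu>_eq doubled_part_and_twos_def intro!: image_eqI[of _ _ a])
      with doubled raised show ?thesis
        using not_semigroup_doubled_part_and_twos[OF doubled(1,2)]
          semigroup_raised_doubled_part_and_twos[OF assms doubled(1,2)]
        by (auto simp: \<mu>_eq)
    qed
  qed
  then show ?thesis using doubled_part_and_twos_subset by blast
qed

lemma card_semigroup_largest_part_simple:
  assumes "1 \<le> p"
  shows "card {\<nu> \<in> partitions_without_ones (2 * p + 5).
      semigroup_with_ones (Suc p) \<nu> \<and> \<not> repeats_largest_part \<nu>}
    = card {\<mu> \<in> partitions_without_ones (2 * p + 4). semigroup_with_ones p \<mu>} + p"
    (is "card ?U = card ?B + p")
proof -
  have "raise_largest_part ` partitions_without_ones (2 * p + 4)
      = {\<nu> \<in> partitions_without_ones (2 * p + 5). \<not> repeats_largest_part \<nu>}"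
    using raise_largest_part_image[of "2 * p + 4"] by (simp add: add.commute)
  then have "?U = {\<nu> \<in> raise_largest_part ` partitions_without_ones (2 * p + 4).
      semigroup_with_ones (Suc p) \<nu>}"
    by auto
  also have "\<dots> = raise_largest_part ` {\<mu> \<in> partitions_without_ones (2 * p + 4).
      semigroup_with_ones (Suc p) (raise_largest_part \<mu>)}" by blast
  also have "\<dots> = raise_largest_part ` (?B \<union> doubled_part_and_twos p)"
    unfolding semigroup_raise_largest_part[OF assms] ..
  finally have "card ?U = card (?B \<union> doubled_part_and_twos p)"
    by (simp add: card_image inj_on_subset[OF inj_raise_largest_part])
  also have "\<dots> = card ?B + card (doubled_part_and_twos p)"
  proof (rule card_Un_disjoint)
    show "?B \<inter> doubled_part_and_twos p = {}"
      using not_semigroup_doubled_part_and_twos by (auto simp: doubled_part_and_twos_def)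
  qed (simp_all add: finite_partitions_without_ones doubled_part_and_twos_def)
  finally show ?thesis by (simp add: card_doubled_part_and_twos)
qed


section \<open>Repeated largest part\<close>

definition doubled_part_three_and_twos :: "nat \<Rightarrow> nat list set" where
  "doubled_part_three_and_twos p = (\<lambda>a. a # a # 3 # replicate (p - a) 2) ` {3..p}"

lemma card_doubled_part_three_and_twos: "card (doubled_part_three_and_twos p) = p - 2"
  unfolding doubled_part_three_and_twos_def by (subst card_image) (auto simp: inj_on_def)

lemma doubled_part_three_and_twos_subset:
  "doubled_part_three_and_twos p
    \<subseteq> {\<mu> \<in> partitions_without_ones (2 * p + 3). repeats_largest_part \<mu>}"
  by (auto simp: doubled_part_three_and_twos_def partitions_without_ones_iff sum_list_replicate
      sorted_wrt_ge_replicate)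

lemma semigroup_with_ones_repeated_part:
  assumes sorted: "sorted_wrt (\<ge>) (x # ys)" and parts_ge_2: "\<forall>y\<in>set (x # ys). 2 \<le> y"
    and hook_le: "x + length ys \<le> Suc p"
  shows "semigroup_with_ones p (x # x # ys) \<longleftrightarrow> x + length ys \<noteq> Suc p"
proof
  assume "semigroup_with_ones p (x # x # ys)"
  then show "x + length ys \<noteq> Suc p"
    using not_semigroup_with_ones_if_hook[of "x # x # ys" p] parts_ge_2 by auto
next
  assume "x + length ys \<noteq> Suc p"
  moreover have "\<forall>h\<in>first_column_hooks (x # ys). h \<le> Suc p"
    using first_column_hooks_upper_bound[OF sorted] hook_le by fastforce
  ultimately show "semigroup_with_ones p (x # x # ys)"
    using parts_ge_2 hook_le by (subst semigroup_with_ones_Cons) fastforce+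
qed

lemma doubled_part_three_and_twos_iff:
  assumes "x # x # ys \<in> partitions_without_ones (2 * p + 3)"
  shows "x # x # ys \<in> doubled_part_three_and_twos p \<longleftrightarrow> x + length ys = Suc p"
proof
  assume len: "x + length ys = Suc p"
  have sorted: "sorted_wrt (\<ge>) (x # ys)" and parts_ge_2: "\<forall>y\<in>set ys. 2 \<le> y"
    and sum: "2 * x + sum_list ys = 2 * p + 3"
    using assms by (auto simp: partitions_without_ones_iff)
  with len have "sum_list ys = Suc (2 * length ys)" by simp
  with parts_ge_2 sorted obtain n where ys: "ys = 3 # replicate n 2"
    by (auto elim: sum_list_eq_Suc_mult_length[of ys 2])
  with sorted len have "3 \<le> x" "x + n = p" by auto
  with ys show "x # x # ys \<in> doubled_part_three_and_twos p"
    by (auto simp: doubled_part_three_and_twos_def intro!: image_eqI[of _ _ x])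
qed (auto simp: doubled_part_three_and_twos_def)

lemma semigroup_repeats_largest_part:
  "{\<mu> \<in> partitions_without_ones (2 * p + 3). semigroup_with_ones p \<mu> \<and> repeats_largest_part \<mu>}
    = {\<mu> \<in> partitions_without_ones (2 * p + 3). repeats_largest_part \<mu>}
      - doubled_part_three_and_twos p"
proof -
  have "semigroup_with_ones p \<mu> \<longleftrightarrow> \<mu> \<notin> doubled_part_three_and_twos p"
    if \<mu>: "\<mu> \<in> partitions_without_ones (2 * p + 3)" "repeats_largest_part \<mu>" for \<mu>
  proof -
    obtain x ys where \<mu>_eq: "\<mu> = x # x # ys"
      using \<mu>(2) by (cases \<mu> rule: repeats_largest_part.cases) auto
    have sorted: "sorted_wrt (\<ge>) (x # ys)" and parts_ge_2: "\<forall>y\<in>set (x # ys). 2 \<le> y"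
      and sum: "2 * x + sum_list ys = 2 * p + 3"
      using \<mu>(1) by (auto simp: \<mu>_eq partitions_without_ones_iff)
    have "x + length ys \<le> Suc p" using sum parts_ge_2 mult_length_le_sum_list[of ys 2] by simp
    with sorted parts_ge_2 have "semigroup_with_ones p \<mu> \<longleftrightarrow> x + length ys \<noteq> Suc p"
      unfolding \<mu>_eq by (rule semigroup_with_ones_repeated_part)
    also have "\<dots> \<longleftrightarrow> \<mu> \<notin> doubled_part_three_and_twos p"
      using doubled_part_three_and_twos_iff \<mu>(1) unfolding \<mu>_eq by blast
    finally show ?thesis .
  qed
  then show ?thesis by blast
qed

lemma card_semigroup_repeats_largest_part:
  "card {\<mu> \<in> partitions_without_ones (2 * p + 3). semigroup_with_ones p \<mu> \<and> repeats_largest_part \<mu>}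
      + (p - 2)
    = a_bar (2 * p + 3)"
proof -
  let ?E = "{\<mu> \<in> partitions_without_ones (2 * p + 3). repeats_largest_part \<mu>}"
  let ?X = "doubled_part_three_and_twos p"
  have subset: "?X \<subseteq> ?E" by (rule doubled_part_three_and_twos_subset)
  have finite: "finite ?E" by (simp add: finite_partitions_without_ones)
  have "card (?E - ?X) = card ?E - card ?X"
    using finite_subset[OF subset finite] subset by (rule card_Diff_subset)
  moreover have "card ?X \<le> card ?E" using finite subset by (rule card_mono)
  ultimately show ?thesis
    by (simp add: semigroup_repeats_largest_part a_bar_eq_card card_doubled_part_three_and_twos)
qed

theorem theorem5p8:
  fixes j :: nat
  assumes "j \<ge> 4"
  shows "int (PM (3 * j) j) - int (PM (3 * j - 2) (j - 1)) = int (a_bar (2 * j + 1)) + 1"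
proof -
  define p where "p = j - 2"
  then have j_eq: "j = p + 2" and "2 \<le> p" using assms by auto
  let ?P = "partitions_without_ones (2 * p + 5)"
  let ?A = "{\<mu> \<in> ?P. semigroup_with_ones (Suc p) \<mu>}"
  let ?R = "{\<mu> \<in> ?P. semigroup_with_ones (Suc p) \<mu> \<and> repeats_largest_part \<mu>}"
  let ?U = "{\<mu> \<in> ?P. semigroup_with_ones (Suc p) \<mu> \<and> \<not> repeats_largest_part \<mu>}"
  have "card ?A = card (?R \<union> ?U)" by (rule arg_cong[where f = card]) blast
  also have "\<dots> = card ?R + card ?U"
    by (rule card_Un_disjoint) (auto simp: finite_partitions_without_ones)
  finally have "card ?A = card ?R + card ?U" .
  moreover have "PM (3 * j) j = card ?A"
    using PM_eq_card_semigroup_with_ones[of "2 * p + 5" "Suc p"] by (simp add: j_eq algebra_simps)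
  moreover have "card ?U = PM (3 * j - 2) (j - 1) + p"
    using card_semigroup_largest_part_simple[of p] PM_eq_card_semigroup_with_ones[of "2 * p + 4" p]
      \<open>2 \<le> p\<close> by (simp add: j_eq algebra_simps)
  moreover have "card ?R + (p - 1) = a_bar (2 * j + 1)"
    using card_semigroup_repeats_largest_part[of "Suc p"]
    by (simp add: j_eq numeral_eq_Suc)
  ultimately show ?thesis using \<open>2 \<le> p\<close> by linarith
qed

end
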